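(* Let $A:\mathbb{R}\to\mathbb{R}^{N\times N}$ be locally integrable and let $\mu$ be a growth rate. If $\dot x=A(t)x$ has nonuniform $\mu$-dichotomy with parameters $(\mathrm{P};K,\alpha,\beta,\theta,\nu)$, then for every $\tau\in\mathbb{R}$ the translated equation $\dot x=A(t+\tau)x$ has nonuniform $\mu_\tau$-dichotomy with parameters $(\mathrm{P}_\tau;K_\tau,\alpha,\beta,\theta,\nu)$, where $\mu_\tau(t)=\mu(t+\tau)/\mu(\tau)$ is the $\tau$-translated growth rate, the invariant projector is $s\mapsto\mathrm{P}_\tau(s):=\mathrm{P}(s+\tau)$, and $$K_\tau:=K\cdot\mu(\tau)^{3\,\mathrm{sgn}(\tau)\max\{\theta,\nu\}}.$$
   Context: A growth rate is a strictly increasing differentiable function $\mu:\mathbb{R}\to\mathbb{R}^+$ with $\mu(0)=1$, $\lim_{t\to+\infty}\mu(t)=+\infty$, $\lim_{t\to-\infty}\mu(t)=0$. Let $\Phi$ be the evolution operator of a linear equation $\dot x=B(t)x$ with $B$ locally integrable, and let $\sigma$ be a growth rate. The equation has nonuniform $\sigma$-dichotomy with parameters $(\mathrm{P};K,\alpha,\beta,\theta,\nu)$ if $s\mapsto\mathrm{P}(s)\in\mathbb{R}^{N\times N}$ is an invariant projector, i.e. each $\mathrm{P}(s)$ is a projection and $\mathrm{P}(t)\Phi(t,s)=\Phi(t,s)\mathrm{P}(s)$ for all $t,s\in\mathbb{R}$, and $K\ge1$, $\alpha<0$, $\beta>0$, $\theta,\nu\ge0$ satisfy $\alpha+\theta<0$,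 $\beta-\nu>0$ and $\|\Phi(t,s)\mathrm{P}(s)\|\le K(\sigma(t)/\sigma(s))^\alpha\sigma(s)^{\mathrm{sgn}(s)\theta}$ for $t\ge s$, $\|\Phi(t,s)[\mathrm{Id}-\mathrm{P}(s)]\|\le K(\sigma(t)/\sigma(s))^\beta\sigma(s)^{\mathrm{sgn}(s)\nu}$ for $t\le s$. *)

theory Defs
  imports "HOL-Analysis.Analysis"
begin

definition growth_rate :: "(real \<Rightarrow> real) \<Rightarrow> bool" where
  "growth_rate \<mu> \<longleftrightarrow>
     (\<forall>t. 0 < \<mu> t) \<and> strict_mono \<mu> \<and> (\<forall>t. \<mu> differentiable (at t)) \<and> \<mu> 0 = 1 \<and>
     filterlim \<mu> at_top at_top \<and> (\<mu> \<longlongrightarrow> 0) at_bot"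

definition translated_growth_rate :: "(real \<Rightarrow> real) \<Rightarrow> real \<Rightarrow> real \<Rightarrow> real" where
  "translated_growth_rate \<mu> \<tau> = (\<lambda>t. \<mu> (t + \<tau>) / \<mu> \<tau>)"

definition locally_integrable :: "(real \<Rightarrow> 'a::euclidean_space) \<Rightarrow> bool" where
  "locally_integrable B \<longleftrightarrow> (\<forall>C. compact C \<longrightarrow> B absolutely_integrable_on C)"

text \<open>Solutions of \<open>x' = B(t) x\<close> on the whole line in the sense of Caratheodory, written as the
  integral equation. For locally integrable \<open>B\<close> and continuous \<open>x\<close> the integrand is
  Lebesgue integrable on compact intervals, so the gauge integral is the Lebesgue integral.\<close>
definition linear_ode_solution ::
    "(real \<Rightarrow> real ^ 'n ^ 'n) \<Rightarrow> (real \<Rightarrow> real ^ 'n) \<Rightarrow> bool" where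
  "linear_ode_solution B x \<longleftrightarrow>
     continuous_on UNIV x \<and>
     (\<forall>a b. a \<le> b \<longrightarrow> ((\<lambda>r. B r *v x r) has_integral (x b - x a)) {a..b})"

text \<open>\<open>\<Phi> t s\<close> is the evolution operator from time \<open>s\<close> to time \<open>t\<close>. For locally integrable \<open>B\<close>
  the last clause follows from the first two by uniqueness of Caratheodory solutions; stating it
  makes \<open>\<Phi>\<close> visibly unique (lemma \<open>evolution_operator_unique\<close>), so that speaking of a relation
  to \<open>\<Phi>\<close> instead of a function of \<open>B\<close> involves no choice.\<close>
definition evolution_operator ::
    "(real \<Rightarrow> real ^ 'n ^ 'n) \<Rightarrow> (real \<Rightarrow> real \<Rightarrow> real ^ 'n ^ 'n) \<Rightarrow> bool" where
  "evolution_operator B \<Phi> \<longleftrightarrow>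
     (\<forall>s. \<Phi> s s = mat 1) \<and>
     (\<forall>s \<xi>. linear_ode_solution B (\<lambda>t. \<Phi> t s *v \<xi>)) \<and>
     (\<forall>x. linear_ode_solution B x \<longrightarrow> (\<forall>t s. x t = \<Phi> t s *v x s))"

lemma evolution_operator_unique:
  assumes "evolution_operator B \<Phi>" "evolution_operator B \<Psi>"
  shows "\<Phi> = \<Psi>"
proof (intro ext)
  fix t s
  have "\<Phi> t s *v \<xi> = \<Psi> t s *v (\<Phi> s s *v \<xi>)" for \<xi>
    using assms unfolding evolution_operator_def by blast
  then show "\<Phi> t s = \<Psi> t s"
    using assms(1) by (simp add: evolution_operator_def matrix_eq)
qed

definition invariant_projector ::
    "(real \<Rightarrow> real \<Rightarrow> real ^ 'n ^ 'n) \<Rightarrow> (real \<Rightarrow> real ^ 'n ^ 'n) \<Rightarrow> bool" where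
  "invariant_projector \<Phi> P \<longleftrightarrow>
     (\<forall>s. P s ** P s = P s) \<and> (\<forall>t s. P t ** \<Phi> t s = \<Phi> t s ** P s)"

text \<open>The matrix norm induced by the Euclidean norm; note that \<open>norm\<close> on \<open>real ^ 'n ^ 'n\<close> is the
  Frobenius norm.\<close>
abbreviation matrix_opnorm :: "real ^ 'n ^ 'n \<Rightarrow> real" where
  "matrix_opnorm M \<equiv> onorm (\<lambda>x. M *v x)"

text \<open>The standing assumptions on \<open>B\<close> and \<open>\<sigma>\<close> are part of the notion, so establishing a
  dichotomy includes establishing them.\<close>
definition nonuniform_dichotomy ::
    "(real \<Rightarrow> real ^ 'n ^ 'n) \<Rightarrow> (real \<Rightarrow> real) \<Rightarrow> (real \<Rightarrow> real ^ 'n ^ 'n) \<Rightarrow>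
     real \<Rightarrow> real \<Rightarrow> real \<Rightarrow> real \<Rightarrow> real \<Rightarrow> bool" where
  "nonuniform_dichotomy B \<sigma> P K \<alpha> \<beta> \<theta> \<nu> \<longleftrightarrow>
     locally_integrable B \<and> growth_rate \<sigma> \<and>
     K \<ge> 1 \<and> \<alpha> < 0 \<and> \<beta> > 0 \<and> \<theta> \<ge> 0 \<and> \<nu> \<ge> 0 \<and> \<alpha> + \<theta> < 0 \<and> \<beta> - \<nu> > 0 \<and>
     (\<exists>\<Phi>. evolution_operator B \<Phi> \<and> invariant_projector \<Phi> P \<and>
       (\<forall>t s. t \<ge> s \<longrightarrow> matrix_opnorm (\<Phi> t s ** P s)
          \<le> K * (\<sigma> t / \<sigma> s) powr \<alpha> * \<sigma> s powr (sgn s * \<theta>)) \<and>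
       (\<forall>t s. t \<le> s \<longrightarrow> matrix_opnorm (\<Phi> t s ** (mat 1 - P s))
          \<le> K * (\<sigma> t / \<sigma> s) powr \<beta> * \<sigma> s powr (sgn s * \<nu>)))"

end

theory Submission
  imports Defs
begin

text \<open>Translation turns the evolution operator into \<open>\<Phi> (t + \<tau>) (s + \<tau>)\<close> and leaves the quotients
  \<open>\<mu> t / \<mu> s\<close> unchanged, so only the nonuniform factor has to be compared. Since
  \<open>sgn s * ln (\<sigma> s) = \<bar>ln (\<sigma> s)\<bar>\<close> for a growth rate \<open>\<sigma>\<close>, this factor is \<open>exp (\<theta> * \<bar>ln (\<sigma> s)\<bar>)\<close>,
  and the comparison is the triangle inequality for \<open>ln (\<mu> (s + \<tau>)) = ln (\<mu>\<^sub>\<tau> s) + ln (\<mu> \<tau>)\<close>.\<close>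

text \<open>On a compact interval, absolute integrability means integrability of \<open>B\<close>
  and of \<open>norm (B t)\<close>, and both survive a shift. An arbitrary compact set is reached by
  enclosing it in such an interval and restricting to a measurable subset.\<close>

lemma locally_integrable_translate:
  fixes B :: "real \<Rightarrow> 'a::euclidean_space"
  assumes "locally_integrable B"
  shows "locally_integrable (\<lambda>t. B (t + \<tau>))"
  unfolding locally_integrable_def
proof (intro allI impI)
  fix C :: "real set"
  assume C: "compact C"
  then obtain a b where ab: "C \<subseteq> {a..b}"
    using bounded_subset_cbox_symmetric[OF compact_imp_bounded] by (metis cbox_interval)
  have "B absolutely_integrable_on {a + \<tau>..b + \<tau>}"
    using assms by (simp add: locally_integrable_def)
  then have "(\<lambda>t. B (t + \<tau>)) absolutely_integrable_on {a..b}"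
    using integrable_shift_real_ivl[of B "a + \<tau>" "b + \<tau>" \<tau>]
      integrable_shift_real_ivl[of "\<lambda>t. norm (B t)" "a + \<tau>" "b + \<tau>" \<tau>]
    by (simp add: absolutely_integrable_on_def)
  moreover have "C \<in> sets lebesgue"
    using C by (simp add: compact_imp_closed)
  ultimately show "(\<lambda>t. B (t + \<tau>)) absolutely_integrable_on C"
    using ab by (rule set_integrable_subset)
qed

lemma linear_ode_solution_translate:
  assumes "linear_ode_solution B x"
  shows "linear_ode_solution (\<lambda>t. B (t + \<tau>)) (\<lambda>t. x (t + \<tau>))"
  unfolding linear_ode_solution_def
proof (intro conjI allI impI)
  have "continuous_on UNIV x"
    using assms by (simp add: linear_ode_solution_def)
  then show "continuous_on UNIV (\<lambda>t. x (t + \<tau>))"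
    by (rule continuous_on_compose2) (auto intro: continuous_intros)
  fix a b :: real
  assume "a \<le> b"
  then have "((\<lambda>r. B r *v x r) has_integral (x (b + \<tau>) - x (a + \<tau>))) {a + \<tau>..b + \<tau>}"
    using assms by (simp add: linear_ode_solution_def)
  from has_integral_shift_real_ivl[OF this, of \<tau>]
  show "((\<lambda>r. B (r + \<tau>) *v x (r + \<tau>)) has_integral (x (b + \<tau>) - x (a + \<tau>))) {a..b}"
    by simp
qed

lemma evolution_operator_translate:
  assumes "evolution_operator B \<Phi>"
  shows "evolution_operator (\<lambda>t. B (t + \<tau>)) (\<lambda>t s. \<Phi> (t + \<tau>) (s + \<tau>))"
  unfolding evolution_operator_def
proof (intro conjI allI impI)
  show "\<Phi> (s + \<tau>) (s + \<tau>) = mat 1" for s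
    using assms by (simp add: evolution_operator_def)
  have "linear_ode_solution B (\<lambda>t. \<Phi> t (s + \<tau>) *v \<xi>)" for s \<xi>
    using assms by (simp add: evolution_operator_def)
  from linear_ode_solution_translate[OF this]
  show "linear_ode_solution (\<lambda>t. B (t + \<tau>)) (\<lambda>t. \<Phi> (t + \<tau>) (s + \<tau>) *v \<xi>)" for s \<xi> .
  fix x t s
  assume "linear_ode_solution (\<lambda>t. B (t + \<tau>)) x"
  \<comment> \<open>Shifting back by \<open>- \<tau>\<close> undoes the translation of the
    coefficient, so the representation of solutions by \<open>\<Phi>\<close> becomes
    available.\<close>
  from linear_ode_solution_translate[OF this, of "- \<tau>"]
  have "linear_ode_solution B (\<lambda>t. x (t - \<tau>))"
    by simp
  then have "x (t + \<tau> - \<tau>) = \<Phi> (t + \<tau>) (s + \<tau>) *v x (s + \<tau> - \<tau>)"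
    using assms unfolding evolution_operator_def by blast
  then show "x t = \<Phi> (t + \<tau>) (s + \<tau>) *v x s"
    by simp
qed

text \<open>Dividing by the positive constant \<open>\<mu> \<tau>\<close> restores the value 1 at 0;
  monotonicity, differentiability and both limits are stable under a shift and a positive
  scaling.\<close>

lemma growth_rate_translate:
  assumes "growth_rate \<mu>"
  shows "growth_rate (translated_growth_rate \<mu> \<tau>)"
proof -
  have pos: "0 < \<mu> t" and mono: "strict_mono \<mu>" and diff: "\<mu> differentiable (at t)"
    and top: "filterlim \<mu> at_top at_top" and bot: "(\<mu> \<longlongrightarrow> 0) at_bot" for t
    using assms by (auto simp: growth_rate_def)
  have "strict_mono (\<lambda>t. \<mu> (t + \<tau>) / \<mu> \<tau>)"
    using mono pos by (auto simp: strict_mono_def divide_strict_right_mono)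
  moreover have "(\<lambda>t. \<mu> (t + \<tau>) / \<mu> \<tau>) differentiable (at t)" for t
  proof -
    have "(\<mu> \<circ> (\<lambda>t. t + \<tau>)) differentiable (at t)"
      by (intro differentiable_chain_at diff) simp
    then show ?thesis
      using pos[of \<tau>] by (intro differentiable_divide) (simp_all add: o_def)
  qed
  moreover have "filterlim (\<lambda>t. \<mu> (t + \<tau>) / \<mu> \<tau>) at_top at_top"
  proof -
    have "filterlim (\<lambda>t. \<tau> + t) at_top at_top"
      by (intro filterlim_tendsto_add_at_top[OF tendsto_const] filterlim_ident)
    from filterlim_compose[OF top this] pos[of \<tau>]
    have "filterlim (\<lambda>t. inverse (\<mu> \<tau>) * \<mu> (\<tau> + t)) at_top at_top"
      by (intro filterlim_tendsto_pos_mult_at_top[OF tendsto_const]) auto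
    then show ?thesis
      by (simp only: divide_inverse mult.commute add.commute)
  qed
  moreover have "((\<lambda>t. \<mu> (t + \<tau>) / \<mu> \<tau>) \<longlongrightarrow> 0) at_bot"
  proof -
    have "filterlim (\<lambda>t. \<tau> + t) at_bot at_bot"
      by (simp add: filterlim_tendsto_add_at_bot_iff[OF tendsto_const] filterlim_ident)
    from filterlim_compose[OF bot this]
    have "((\<lambda>t. \<mu> (t + \<tau>)) \<longlongrightarrow> 0) at_bot"
      by (simp add: add.commute)
    then show ?thesis
      by (rule tendsto_divide_zero)
  qed
  ultimately show ?thesis
    using pos less_imp_neq[OF pos[of \<tau>]] unfolding growth_rate_def translated_growth_rate_def
    by simp
qed

text \<open>A growth rate increases strictly through 1 at 0, so \<open>ln (\<sigma> s)\<close> has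
  the sign of \<open>s\<close>. This form removes the case distinctions on the signs of
  \<open>s\<close>, \<open>\<tau>\<close> and \<open>s + \<tau>\<close> from later
  estimates.\<close>

lemma growth_rate_powr_sgn:
  assumes "growth_rate \<sigma>"
  shows "\<sigma> s powr (sgn s * c) = exp (c * \<bar>ln (\<sigma> s)\<bar>)"
proof -
  have pos: "0 < \<sigma> s" and one: "\<sigma> 0 = 1" and mono: "strict_mono \<sigma>"
    using assms by (auto simp: growth_rate_def)
  have "sgn s * ln (\<sigma> s) = \<bar>ln (\<sigma> s)\<bar>"
  proof (cases s "0::real" rule: linorder_cases)
    case less
    then have "\<sigma> s < 1"
      using strict_monoD[OF mono less] one by simp
    with less pos show ?thesis
      by simp
  next
    case greater
    then have "1 < \<sigma> s"
      using strict_monoD[OF mono greater] one by simp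
    with greater show ?thesis
      by simp
  qed (simp add: one)
  with pos show ?thesis
    by (simp add: powr_def mult_ac)
qed

text \<open>The bound \<open>M\<close> is kept apart from \<open>c\<close> so that one constant,
  later \<open>max \<theta> \<nu>\<close>, serves both exponents.\<close>

lemma translated_growth_rate_powr_le:
  assumes \<mu>: "growth_rate \<mu>" and c: "0 \<le> c" "c \<le> M"
  shows "\<mu> (s + \<tau>) powr (sgn (s + \<tau>) * c)
    \<le> \<mu> \<tau> powr (3 * sgn \<tau> * M) * translated_growth_rate \<mu> \<tau> s powr (sgn s * c)"
proof -
  have pos: "0 < \<mu> t" for t
    using \<mu> by (simp add: growth_rate_def)
  have "\<bar>ln (\<mu> (s + \<tau>))\<bar> \<le> \<bar>ln (\<mu> \<tau>)\<bar> + \<bar>ln (translated_growth_rate \<mu> \<tau> s)\<bar>"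
    using pos[of \<tau>] pos[of "s + \<tau>"] by (simp add: translated_growth_rate_def ln_div)
  from mult_left_mono[OF this c(1)]
  have "c * \<bar>ln (\<mu> (s + \<tau>))\<bar>
      \<le> c * \<bar>ln (\<mu> \<tau>)\<bar> + c * \<bar>ln (translated_growth_rate \<mu> \<tau> s)\<bar>"
    by (simp only: distrib_left)
  \<comment> \<open>The triangle inequality gives the coefficient \<open>c\<close>; it is enlarged
    to the \<open>3 * M\<close> prescribed by the claimed constant, using
    \<open>0 \<le> c \<le> M\<close>.\<close>
  also have "c * \<bar>ln (\<mu> \<tau>)\<bar> \<le> (3 * M) * \<bar>ln (\<mu> \<tau>)\<bar>"
    using c by (intro mult_right_mono) auto
  finally have "exp (c * \<bar>ln (\<mu> (s + \<tau>))\<bar>)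
      \<le> exp ((3 * M) * \<bar>ln (\<mu> \<tau>)\<bar>) * exp (c * \<bar>ln (translated_growth_rate \<mu> \<tau> s)\<bar>)"
    by (simp flip: exp_add)
  moreover have "\<mu> \<tau> powr (3 * sgn \<tau> * M) = exp ((3 * M) * \<bar>ln (\<mu> \<tau>)\<bar>)"
    using growth_rate_powr_sgn[OF \<mu>, of \<tau> "3 * M"] by (simp add: mult_ac)
  ultimately show ?thesis
    by (simp add: growth_rate_powr_sgn[OF \<mu>] growth_rate_powr_sgn[OF growth_rate_translate[OF \<mu>]])
qed

text \<open>Common form of both dichotomy estimates: \<open>x\<close> stands for the operator norm,
  and \<open>(\<gamma>, c)\<close> for \<open>(\<alpha>, \<theta>)\<close> or
  \<open>(\<beta>, \<nu>)\<close>. The factor \<open>\<mu> \<tau>\<close> cancels in the quotient of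
  translated rates, whatever the order of \<open>t\<close> and \<open>s\<close>.\<close>

lemma dichotomy_bound_translate:
  assumes \<mu>: "growth_rate \<mu>" and c: "0 \<le> c" "c \<le> M" and K: "0 \<le> K"
    and bound: "x \<le> K * (\<mu> (t + \<tau>) / \<mu> (s + \<tau>)) powr \<gamma> * \<mu> (s + \<tau>) powr (sgn (s + \<tau>) * c)"
  shows "x \<le> K * \<mu> \<tau> powr (3 * sgn \<tau> * M)
    * (translated_growth_rate \<mu> \<tau> t / translated_growth_rate \<mu> \<tau> s) powr \<gamma>
    * translated_growth_rate \<mu> \<tau> s powr (sgn s * c)"
proof -
  have "0 < \<mu> \<tau>"
    using \<mu> by (simp add: growth_rate_def)
  then have quot: "translated_growth_rate \<mu> \<tau> t / translated_growth_rate \<mu> \<tau> s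
      = \<mu> (t + \<tau>) / \<mu> (s + \<tau>)"
    by (simp add: translated_growth_rate_def)
  note bound
  also have "K * (\<mu> (t + \<tau>) / \<mu> (s + \<tau>)) powr \<gamma> * \<mu> (s + \<tau>) powr (sgn (s + \<tau>) * c)
      \<le> K * (\<mu> (t + \<tau>) / \<mu> (s + \<tau>)) powr \<gamma>
        * (\<mu> \<tau> powr (3 * sgn \<tau> * M) * translated_growth_rate \<mu> \<tau> s powr (sgn s * c))"
    using K by (intro mult_left_mono translated_growth_rate_powr_le[OF \<mu> c]) simp
  finally show ?thesis
    by (simp only: quot mult_ac)
qed

theorem lemma2p3:
  fixes A :: "real \<Rightarrow> real ^ 'n ^ 'n"
    and \<mu> :: "real \<Rightarrow> real"
    and P :: "real \<Rightarrow> real ^ 'n ^ 'n"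
    and K \<alpha> \<beta> \<theta> \<nu> :: real
  assumes "locally_integrable A"
    and "growth_rate \<mu>"
    and "nonuniform_dichotomy A \<mu> P K \<alpha> \<beta> \<theta> \<nu>"
  shows "\<forall>\<tau>. nonuniform_dichotomy (\<lambda>t. A (t + \<tau>)) (translated_growth_rate \<mu> \<tau>)
           (\<lambda>s. P (s + \<tau>)) (K * \<mu> \<tau> powr (3 * sgn \<tau> * max \<theta> \<nu>)) \<alpha> \<beta> \<theta> \<nu>"
proof
  fix \<tau> :: real
  obtain \<Phi> where params: "1 \<le> K" "\<alpha> < 0" "0 < \<beta>" "0 \<le> \<theta>" "0 \<le> \<nu>" "\<alpha> + \<theta> < 0" "0 < \<beta> - \<nu>"
    and ev: "evolution_operator A \<Phi>" and inv: "invariant_projector \<Phi> P"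
    and stable: "\<And>t s. s \<le> t \<Longrightarrow> matrix_opnorm (\<Phi> t s ** P s)
          \<le> K * (\<mu> t / \<mu> s) powr \<alpha> * \<mu> s powr (sgn s * \<theta>)"
    and unstable: "\<And>t s. t \<le> s \<Longrightarrow> matrix_opnorm (\<Phi> t s ** (mat 1 - P s))
          \<le> K * (\<mu> t / \<mu> s) powr \<beta> * \<mu> s powr (sgn s * \<nu>)"
    using assms(3) unfolding nonuniform_dichotomy_def by auto
  \<comment> \<open>The new constant must again be at least 1: as an exponential of a nonnegative
    number, the factor multiplying \<open>K\<close> is at least 1 for either sign of \<tau>.\<close>
  have "\<mu> \<tau> powr (3 * sgn \<tau> * max \<theta> \<nu>) = exp (3 * max \<theta> \<nu> * \<bar>ln (\<mu> \<tau>)\<bar>)"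
    using growth_rate_powr_sgn[OF assms(2), of \<tau> "3 * max \<theta> \<nu>"] by (simp add: mult_ac)
  then have "1 \<le> \<mu> \<tau> powr (3 * sgn \<tau> * max \<theta> \<nu>)"
    using params(4) by (simp add: le_max_iff_disj)
  then have "1 \<le> K * \<mu> \<tau> powr (3 * sgn \<tau> * max \<theta> \<nu>)"
    using mult_mono[OF params(1), of 1] params(1) by simp
  moreover have "invariant_projector (\<lambda>t s. \<Phi> (t + \<tau>) (s + \<tau>)) (\<lambda>s. P (s + \<tau>))"
    using inv by (simp add: invariant_projector_def)
  moreover have "matrix_opnorm (\<Phi> (t + \<tau>) (s + \<tau>) ** P (s + \<tau>))
      \<le> K * \<mu> \<tau> powr (3 * sgn \<tau> * max \<theta> \<nu>)
        * (translated_growth_rate \<mu> \<tau> t / translated_growth_rate \<mu> \<tau> s) powr \<alpha>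
        * translated_growth_rate \<mu> \<tau> s powr (sgn s * \<theta>)" if "s \<le> t" for t s
    \<comment> \<open>The original estimate is taken at the times \<open>t + \<tau>\<close> and
      \<open>s + \<tau>\<close>, whose order is that of \<open>t\<close> and
      \<open>s\<close>.\<close>
    using params that by (intro dichotomy_bound_translate[OF assms(2)] stable) auto
  moreover have "matrix_opnorm (\<Phi> (t + \<tau>) (s + \<tau>) ** (mat 1 - P (s + \<tau>)))
      \<le> K * \<mu> \<tau> powr (3 * sgn \<tau> * max \<theta> \<nu>)
        * (translated_growth_rate \<mu> \<tau> t / translated_growth_rate \<mu> \<tau> s) powr \<beta>
        * translated_growth_rate \<mu> \<tau> s powr (sgn s * \<nu>)" if "t \<le> s" for t s
    using params that by (intro dichotomy_bound_translate[OF assms(2)] unstable) auto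
  ultimately show "nonuniform_dichotomy (\<lambda>t. A (t + \<tau>)) (translated_growth_rate \<mu> \<tau>)
      (\<lambda>s. P (s + \<tau>)) (K * \<mu> \<tau> powr (3 * sgn \<tau> * max \<theta> \<nu>)) \<alpha> \<beta> \<theta> \<nu>"
    unfolding nonuniform_dichotomy_def
    using params locally_integrable_translate[OF assms(1)] growth_rate_translate[OF assms(2)]
      evolution_operator_translate[OF ev]
    by blast
qed

end
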